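(* Let $x,y\ge 1$ be integers with $x \neq 3$ and $y \neq 3$. Then $\left|\mathcal{F}(K_{x,y})\right| = 1$.
   Context: All graphs are finite, undirected and simple, and are considered up to isomorphism. $K_{x,y}$ is the complete bipartite graph with parts of sizes $x$ and $y$. A Triangle-Y ($\nabla Y$) move on a graph takes a 3-cycle with vertices $a,b,c$, deletes the edges $ab,bc,ca$, and adds a new vertex $v$ with edges $av,bv,cv$. A Y-Triangle ($Y\nabla$) move is the inverse operation: for a vertex $v$ of degree three whose neighbours $a,b,c$ are pairwise non-adjacent, delete $v$ and add the edges $ab,bc,ca$. Two graphs are cousins if one is obtained from the other by a sequence of zero or more $\nabla Y$ and $Y\nabla$ moves. The family $\mathcal{F}(G)$ is the set of (isomorphism classes of) cousins of $G$, and $|\mathcal{F}(G)|$ is its size. *)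

theory Defs
  imports "Graph_Theory.Graph_Theory"
begin

text \<open>
  A finite simple undirected graph is a \<^const>\<open>pair_graph\<close>: a finite, loop-free, symmetric digraph
  without parallel arcs, the edge \<open>ab\<close> being the pair of arcs \<open>(a,b)\<close>, \<open>(b,a)\<close>.
\<close>

definition triangle_arcs :: "'a \<Rightarrow> 'a \<Rightarrow> 'a \<Rightarrow> 'a rel" where
  "triangle_arcs a b c = {(a,b), (b,a), (b,c), (c,b), (c,a), (a,c)}"

definition star_arcs :: "'a \<Rightarrow> 'a \<Rightarrow> 'a \<Rightarrow> 'a \<Rightarrow> 'a rel" where
  "star_arcs v a b c = {(a,v), (v,a), (b,v), (v,b), (c,v), (v,c)}"

definition triangle_Y :: "'a pair_pre_digraph \<Rightarrow> 'a pair_pre_digraph \<Rightarrow> bool" where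
  "triangle_Y G H \<longleftrightarrow> pair_graph G \<and>
     (\<exists>a b c v. distinct [a, b, c] \<and> triangle_arcs a b c \<subseteq> parcs G \<and> v \<notin> pverts G \<and>
        H = \<lparr> pverts = pverts G \<union> {v},
              parcs = (parcs G - triangle_arcs a b c) \<union> star_arcs v a b c \<rparr>)"

definition Y_triangle :: "'a pair_pre_digraph \<Rightarrow> 'a pair_pre_digraph \<Rightarrow> bool" where
  "Y_triangle G H \<longleftrightarrow> pair_graph G \<and>
     (\<exists>a b c v. v \<in> pverts G \<and> distinct [a, b, c] \<and> {w. (v, w) \<in> parcs G} = {a, b, c} \<and>
        triangle_arcs a b c \<inter> parcs G = {} \<and>
        H = \<lparr> pverts = pverts G - {v},
              parcs = (parcs G - star_arcs v a b c) \<union> triangle_arcs a b c \<rparr>)"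

definition graph_iso :: "'a pair_pre_digraph rel" where
  "graph_iso = {(G, H). pair_graph G \<and> pair_graph H \<and> digraph_iso (with_proj G) (with_proj H)}"

text \<open>
  Graphs are considered up to isomorphism, so isomorphic graphs may be exchanged at any point of a
  sequence of moves.
\<close>

definition cousin :: "'a pair_pre_digraph \<Rightarrow> 'a pair_pre_digraph \<Rightarrow> bool" where
  "cousin = (\<lambda>G H. triangle_Y G H \<or> Y_triangle G H \<or> (G, H) \<in> graph_iso)\<^sup>*\<^sup>*"

text \<open>
  The set of isomorphism classes of cousins. Vertices are natural numbers: every finite graph has
  an isomorphic copy there, and a fresh vertex for a \<^const>\<open>triangle_Y\<close> move always exists.
\<close>

definition family :: "nat pair_pre_digraph \<Rightarrow> nat pair_pre_digraph set set" where
  "family G = {H. cousin G H} // graph_iso"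

lemma sym_triangle_arcs: "sym (triangle_arcs a b c)"
  by (rule symI) (simp add: triangle_arcs_def, blast)

lemma sym_star_arcs: "sym (star_arcs v a b c)"
  by (rule symI) (simp add: star_arcs_def, blast)

lemma sym_diff: "sym A \<Longrightarrow> sym B \<Longrightarrow> sym (A - B)"
  unfolding sym_def by blast

lemma triangle_Y_pair_graph:
  assumes "triangle_Y G H"
  shows "pair_graph H"
proof -
  from assms obtain a b c v where G: "pair_graph G"
    and T: "distinct [a, b, c]" "triangle_arcs a b c \<subseteq> parcs G" "v \<notin> pverts G"
    and H: "H = \<lparr> pverts = pverts G \<union> {v},
              parcs = (parcs G - triangle_arcs a b c) \<union> star_arcs v a b c \<rparr>"
    unfolding triangle_Y_def by blast
  interpret pair_graph G by fact
  have V: "a \<in> pverts G" "b \<in> pverts G" "c \<in> pverts G"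
    using T(2) in_arcsD1 unfolding triangle_arcs_def by blast+
  show ?thesis
  proof
    show "symmetric (with_proj H)"
      unfolding symmetric_def H with_proj_simps pair_pre_digraph.simps
      by (intro sym_Un sym_diff sym_triangle_arcs sym_star_arcs) (rule symI, erule arcs_symmetric)
    show "fst e \<in> pverts H" "snd e \<in> pverts H" if "e \<in> parcs H" for e
      using that V wellformed unfolding H by (auto simp: star_arcs_def)
    show "fst e \<noteq> snd e" if "e \<in> parcs H" for e
      using that V T(3) no_loops unfolding H by (auto simp: star_arcs_def)
  qed (simp_all add: H star_arcs_def)
qed

lemma Y_triangle_pair_graph:
  assumes "Y_triangle G H"
  shows "pair_graph H"
proof -
  from assms obtain a b c v where G: "pair_graph G"
    and T: "v \<in> pverts G" "distinct [a, b, c]" "{w. (v, w) \<in> parcs G} = {a, b, c}"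
    and H: "H = \<lparr> pverts = pverts G - {v},
              parcs = (parcs G - star_arcs v a b c) \<union> triangle_arcs a b c \<rparr>"
    unfolding Y_triangle_def by blast
  interpret pair_graph G by fact
  have N: "(v, w) \<in> parcs G \<longleftrightarrow> w = a \<or> w = b \<or> w = c" for w
    using T(3) by blast
  have N': "(w, v) \<in> parcs G \<longleftrightarrow> w = a \<or> w = b \<or> w = c" for w
    using N arcs_symmetric by blast
  have V: "a \<in> pverts G" "b \<in> pverts G" "c \<in> pverts G" "a \<noteq> v" "b \<noteq> v" "c \<noteq> v"
    using N in_arcsD2 no_loops' by blast+
  show ?thesis
  proof
    show "symmetric (with_proj H)"
      unfolding symmetric_def H with_proj_simps pair_pre_digraph.simps
      by (intro sym_Un sym_diff sym_triangle_arcs sym_star_arcs) (rule symI, erule arcs_symmetric)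
    have S: "fst e \<noteq> v \<and> snd e \<noteq> v" if "e \<in> parcs G - star_arcs v a b c" for e
      using that N N' by (cases e) (auto simp: star_arcs_def)
    show "fst e \<in> pverts H" "snd e \<in> pverts H" if "e \<in> parcs H" for e
      using that V S[of e] wellformed unfolding H by (auto simp: triangle_arcs_def)
    show "fst e \<noteq> snd e" if "e \<in> parcs H" for e
      using that T(2) no_loops unfolding H by (auto simp: triangle_arcs_def)
  qed (simp_all add: H triangle_arcs_def)
qed

lemma Y_triangle_iff_triangle_Y: "Y_triangle G H \<longleftrightarrow> triangle_Y H G"
proof
  assume Y: "Y_triangle G H"
  then obtain a b c v where G: "pair_graph G"
    and T: "v \<in> pverts G" "distinct [a, b, c]" "{w. (v, w) \<in> parcs G} = {a, b, c}"
      "triangle_arcs a b c \<inter> parcs G = {}"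
    and H: "H = \<lparr> pverts = pverts G - {v},
              parcs = (parcs G - star_arcs v a b c) \<union> triangle_arcs a b c \<rparr>"
    unfolding Y_triangle_def by blast
  interpret pair_graph G by fact
  have N: "(v, w) \<in> parcs G \<longleftrightarrow> w = a \<or> w = b \<or> w = c" for w
    using T(3) by blast
  have "star_arcs v a b c \<subseteq> parcs G"
    using N arcs_symmetric unfolding star_arcs_def by blast
  then have "parcs G = (parcs H - triangle_arcs a b c) \<union> star_arcs v a b c"
    using T(4) H by auto
  then have "G = \<lparr> pverts = pverts H \<union> {v},
              parcs = (parcs H - triangle_arcs a b c) \<union> star_arcs v a b c \<rparr>"
    using T(1) H by (intro pair_pre_digraph.equality) auto
  moreover have "triangle_arcs a b c \<subseteq> parcs H" "v \<notin> pverts H"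
    unfolding H by simp_all
  ultimately show "triangle_Y H G"
    unfolding triangle_Y_def using Y_triangle_pair_graph[OF Y] T(2) by blast
next
  assume Y: "triangle_Y H G"
  then obtain a b c v where "pair_graph H"
    and T: "distinct [a, b, c]" "triangle_arcs a b c \<subseteq> parcs H" "v \<notin> pverts H"
    and G: "G = \<lparr> pverts = pverts H \<union> {v},
              parcs = (parcs H - triangle_arcs a b c) \<union> star_arcs v a b c \<rparr>"
    unfolding triangle_Y_def by blast
  interpret pair_graph H by fact
  have V: "a \<noteq> v" "b \<noteq> v" "c \<noteq> v"
    using T in_arcsD1 unfolding triangle_arcs_def by blast+
  have v: "(v, w) \<notin> parcs H" "(w, v) \<notin> parcs H" for w
    using T(3) wellformed' by blast+
  have 1: "{w. (v, w) \<in> parcs G} = {a, b, c}"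
    using v V G by (auto simp: star_arcs_def)
  have 2: "triangle_arcs a b c \<inter> star_arcs v a b c = {}"
    using V by (auto simp: star_arcs_def triangle_arcs_def)
  have "star_arcs v a b c \<inter> parcs H = {}"
    using v by (auto simp: star_arcs_def)
  then have "H = \<lparr> pverts = pverts G - {v},
              parcs = (parcs G - star_arcs v a b c) \<union> triangle_arcs a b c \<rparr>"
    using T 2 G by (intro pair_pre_digraph.equality) auto
  moreover have "triangle_arcs a b c \<inter> parcs G = {}" "v \<in> pverts G"
    unfolding G using 2 by auto
  ultimately show "Y_triangle G H"
    unfolding Y_triangle_def using triangle_Y_pair_graph[OF Y] T(1) 1 by blast
qed

lemma graph_iso_iff_bij:
  assumes "pair_graph G" "pair_graph H"
  shows "(G, H) \<in> graph_iso \<longleftrightarrow>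
    (\<exists>f. bij_betw f (pverts G) (pverts H) \<and> parcs H = map_prod f f ` parcs G)"
proof
  interpret G: pair_graph G by fact
  assume "(G, H) \<in> graph_iso"
  then obtain h where h: "pre_digraph.digraph_isomorphism (with_proj G) h"
    and H: "with_proj H = app_iso h (with_proj G)"
    unfolding graph_iso_def digraph_iso_def by blast
  have "iso_tail h = fst" "iso_head h = snd" and V: "pverts H = iso_verts h ` pverts G"
    and A: "parcs H = iso_arcs h ` parcs G"
    using H unfolding with_proj_def app_iso_def by simp_all
  with h have "iso_arcs h e = map_prod (iso_verts h) (iso_verts h) e" if "e \<in> parcs G" for e
    using that unfolding pre_digraph.digraph_isomorphism_def by (auto simp: prod_eq_iff)
  then have "parcs H = map_prod (iso_verts h) (iso_verts h) ` parcs G"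
    unfolding A by (rule image_cong[OF refl])
  moreover have "bij_betw (iso_verts h) (pverts G) (pverts H)"
    using h V unfolding pre_digraph.digraph_isomorphism_def bij_betw_def by simp
  ultimately show "\<exists>f. bij_betw f (pverts G) (pverts H) \<and> parcs H = map_prod f f ` parcs G"
    by blast
next
  interpret G: pair_graph G by fact
  assume "\<exists>f. bij_betw f (pverts G) (pverts H) \<and> parcs H = map_prod f f ` parcs G"
  then obtain f where f: "inj_on f (pverts G)" "pverts H = f ` pverts G"
    "parcs H = map_prod f f ` parcs G"
    unfolding bij_betw_def by blast
  define h where "h = \<lparr> iso_verts = f, iso_arcs = map_prod f f, iso_head = snd, iso_tail = fst \<rparr>"
  have "inj_on (map_prod f f) (parcs G)"
    by (rule inj_on_subset[OF map_prod_inj_on[OF f(1) f(1)]]) (auto dest: G.wellformed')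
  then have "pre_digraph.digraph_isomorphism (with_proj G) h"
    using f(1) G.wf_digraph unfolding pre_digraph.digraph_isomorphism_def h_def by simp
  moreover have "with_proj H = app_iso h (with_proj G)"
    using f unfolding with_proj_def app_iso_def h_def by simp
  ultimately show "(G, H) \<in> graph_iso"
    unfolding graph_iso_def digraph_iso_def using assms by blast
qed

lemma equiv_graph_iso: "equiv {G :: 'a pair_pre_digraph. pair_graph G} graph_iso"
  (is "equiv ?A ?r")
proof (rule equivI)
  show "?r \<subseteq> ?A \<times> ?A"
    by (auto simp: graph_iso_def)
  show "refl_on ?A ?r"
  proof (rule refl_onI)
    fix G :: "'a pair_pre_digraph"
    assume "G \<in> ?A"
    then show "(G, G) \<in> graph_iso"
      by (simp add: graph_iso_iff_bij) (intro exI[of _ id], simp add: map_prod.id)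
  qed
  show "sym ?r"
  proof (rule symI)
    fix G H :: "'a pair_pre_digraph"
    assume GH: "(G, H) \<in> graph_iso"
    then have pg: "pair_graph G" "pair_graph H" by (auto simp: graph_iso_def)
    interpret G: pair_graph G by fact
    obtain f where f: "bij_betw f (pverts G) (pverts H)" "parcs H = map_prod f f ` parcs G"
      using GH pg graph_iso_iff_bij by blast
    let ?g = "the_inv_into (pverts G) f"
    have "map_prod ?g ?g (map_prod f f e) = e" if "e \<in> parcs G" for e
      using that f(1) by (cases e) (auto simp: bij_betw_def the_inv_into_f_f dest: G.wellformed')
    then have "parcs G = map_prod ?g ?g ` parcs H"
      unfolding f(2) image_image by simp
    then show "(H, G) \<in> graph_iso"
      using pg bij_betw_the_inv_into[OF f(1)] graph_iso_iff_bij by blast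
  qed
  show "trans ?r"
  proof (rule transI)
    fix G H K :: "'a pair_pre_digraph"
    assume GH: "(G, H) \<in> graph_iso" and HK: "(H, K) \<in> graph_iso"
    then have pg: "pair_graph G" "pair_graph H" "pair_graph K" by (auto simp: graph_iso_def)
    obtain f where f: "bij_betw f (pverts G) (pverts H)" "parcs H = map_prod f f ` parcs G"
      using GH pg graph_iso_iff_bij by blast
    obtain g where g: "bij_betw g (pverts H) (pverts K)" "parcs K = map_prod g g ` parcs H"
      using HK pg graph_iso_iff_bij by blast
    have "parcs K = map_prod (g \<circ> f) (g \<circ> f) ` parcs G"
      unfolding g(2) f(2) image_image
      by (simp add: map_prod.compositionality)
    then show "(G, K) \<in> graph_iso"
      using pg bij_betw_trans[OF f(1) g(1)] graph_iso_iff_bij by blast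
  qed
qed

lemma cousin_pair_graph: "cousin G H \<Longrightarrow> pair_graph G \<Longrightarrow> pair_graph H"
  unfolding cousin_def
  by (induction rule: rtranclp_induct)
    (auto simp: graph_iso_def intro: triangle_Y_pair_graph Y_triangle_pair_graph)

lemma complete_bipartite_exists: "\<exists>G :: nat pair_pre_digraph. K\<^bsub>x,y\<^esub> (with_proj G)"
proof -
  let ?U = "{..<x}" and ?V = "{x..<x + y}"
  have "K\<^bsub>x,y\<^esub> (with_proj \<lparr> pverts = ?U \<union> ?V, parcs = ?U \<times> ?V \<union> ?V \<times> ?U \<rparr>)"
    unfolding complete_bipartite_digraph_pair_def
    by (intro conjI exI[of _ ?U] exI[of _ ?V]) auto
  then show ?thesis by blast
qed

end

theory Submission
  imports Defs
begin

text \<open>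
  No move applies to \<open>K\<^bsub>x,y\<^esub>\<close>: it is bipartite, so it has no triangle, and its vertices have degree
  \<open>x\<close> or \<open>y\<close>, so none has degree three. Since these properties are shared by all isomorphic copies,
  every cousin is an isomorphic copy.
\<close>

lemma complete_bipartite_pair_graph:
  assumes "K\<^bsub>x,y\<^esub> (with_proj G)"
  shows "pair_graph G"
  using assms by (auto simp: complete_bipartite_digraph_def intro: pair_graphI_graph)

lemma complete_bipartite_not_triangle_Y:
  assumes "K\<^bsub>x,y\<^esub> (with_proj G)"
  shows "\<not> triangle_Y G H"
proof -
  obtain U V where UV: "U \<inter> V = {}" "parcs G = U \<times> V \<union> V \<times> U"
    using assms unfolding complete_bipartite_digraph_pair_def by blast
  \<comment> \<open>Every arc switches sides, so three arcs in a row cannot lead from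
    \<open>a\<close> back to \<open>a\<close>.\<close>
  then have "\<not> triangle_arcs a b c \<subseteq> parcs G" for a b c
    by (auto simp: triangle_arcs_def)
  then show ?thesis
    unfolding triangle_Y_def by blast
qed

lemma complete_bipartite_not_Y_triangle:
  assumes "K\<^bsub>x,y\<^esub> (with_proj G)" "x \<noteq> 3" "y \<noteq> 3"
  shows "\<not> Y_triangle G H"
proof
  assume "Y_triangle G H"
  then obtain a b c v where v: "v \<in> pverts G" "distinct [a, b, c]"
    "{w. (v, w) \<in> parcs G} = {a, b, c}"
    unfolding Y_triangle_def by blast
  then have "card {w. (v, w) \<in> parcs G} = 3"
    by simp
  moreover obtain U V where UV: "pverts G = U \<union> V" "U \<inter> V = {}" "card U = x" "card V = y"
    "parcs G = U \<times> V \<union> V \<times> U"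
    using assms(1) unfolding complete_bipartite_digraph_pair_def by blast
  \<comment> \<open>The neighbourhood of a vertex is the whole opposite side, so its size is
    \<open>y\<close> or \<open>x\<close>, contradicting the count of three.\<close>
  moreover have "{w. (v, w) \<in> parcs G} = V" if "v \<in> U"
    using that UV by auto
  moreover have "{w. (v, w) \<in> parcs G} = U" if "v \<in> V"
    using that UV by auto
  ultimately show False
    using v(1) assms(2,3) by auto
qed

text \<open>Lets the obstructions to both moves be reapplied after each exchange of isomorphic
  graphs. The sides of \<open>H\<close> are the images of the sides of \<open>G\<close>; injectivity
  on \<open>U \<union> V\<close> keeps them disjoint and of the same sizes.\<close>

lemma complete_bipartite_graph_iso:
  assumes "K\<^bsub>x,y\<^esub> (with_proj G)" "(G, H) \<in> graph_iso"
  shows "K\<^bsub>x,y\<^esub> (with_proj H)"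
proof -
  obtain U V where UV: "finite (pverts G)" "pverts G = U \<union> V" "U \<inter> V = {}" "card U = x"
    "card V = y" "parcs G = U \<times> V \<union> V \<times> U"
    using assms(1) unfolding complete_bipartite_digraph_pair_def by blast
  have "pair_graph G" "pair_graph H"
    using assms(2) by (auto simp: graph_iso_def)
  then obtain f where f: "inj_on f (U \<union> V)" "pverts H = f ` (U \<union> V)"
    "parcs H = map_prod f f ` (U \<times> V \<union> V \<times> U)"
    using assms(2) UV by (auto simp: graph_iso_iff_bij bij_betw_def)
  have "card (f ` U) = x" "card (f ` V) = y"
    using f(1) UV(4,5) by (auto simp: card_image inj_on_Un)
  moreover have "f ` U \<inter> f ` V = {}"
    using inj_on_image_Int[OF f(1), of U V] UV(3) by simp
  moreover have "parcs H = f ` U \<times> f ` V \<union> f ` V \<times> f ` U"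
    unfolding f(3) image_Un by (simp add: map_prod_surj_on[OF refl refl])
  moreover have "finite (pverts H)"
    using f(2) UV(1,2) by simp
  ultimately show ?thesis
    using f(2) unfolding complete_bipartite_digraph_pair_def image_Un by blast
qed

lemma cousin_complete_bipartite_iff:
  assumes "K\<^bsub>x,y\<^esub> (with_proj G)" "x \<noteq> 3" "y \<noteq> 3"
  shows "cousin G H \<longleftrightarrow> (G, H) \<in> graph_iso"
proof
  assume "cousin G H"
  then show "(G, H) \<in> graph_iso"
    unfolding cousin_def
  proof (induction rule: rtranclp_induct)
    case base
    show ?case
      \<comment> \<open>\<open>graph_iso\<close> is reflexive only on pair graphs, so
        \<open>G\<close> must first be known to be one.\<close>
      using complete_bipartite_pair_graph[OF assms(1)] equiv_graph_iso
      by (auto simp: equiv_def refl_on_def)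
  next
    case (step H K)
    \<comment> \<open>By the induction hypothesis \<open>H\<close> is again a copy of the complete
      bipartite graph. This rules out both moves from \<open>H\<close>, so the last step is an
      isomorphism and transitivity applies.\<close>
    have "K\<^bsub>x,y\<^esub> (with_proj H)"
      using complete_bipartite_graph_iso[OF assms(1) step.IH] .
    then have "(H, K) \<in> graph_iso"
      using step.hyps(2) complete_bipartite_not_triangle_Y
        complete_bipartite_not_Y_triangle assms(2,3) by blast
    then show ?case
      using step.IH equiv_graph_iso by (meson equiv_def transE)
  qed
qed (auto simp: cousin_def)

theorem theorem3:
  fixes x y :: nat and G :: "nat pair_pre_digraph"
  assumes "x \<ge> 1" and "y \<ge> 1" and "x \<noteq> 3" and "y \<noteq> 3"
    and "K\<^bsub>x,y\<^esub> (with_proj G)"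
  shows "card (family G) = 1"
proof -
  have G: "pair_graph G"
    using assms(5) by (rule complete_bipartite_pair_graph)
  have "{H. cousin G H} = graph_iso `` {G}"
    using cousin_complete_bipartite_iff[OF assms(5,3,4)] by blast
  \<comment> \<open>The cousins form one isomorphism class, so the quotient collects the classes of
    its members, which all coincide.\<close>
  then have "family G = (\<lambda>H. graph_iso `` {H}) ` (graph_iso `` {G})"
    unfolding family_def quotient_def by blast
  also have "\<dots> = (\<lambda>H. graph_iso `` {G}) ` (graph_iso `` {G})"
    using equiv_class_eq[OF equiv_graph_iso] by (intro image_cong) blast+
  \<comment> \<open>The image of a constant map is a singleton once its domain is nonempty; here the
    domain contains \<open>G\<close> itself.\<close>
  also have "\<dots> = {graph_iso `` {G}}"
    using equiv_class_self[OF equiv_graph_iso, of G] G by (simp add: image_constant_conv) blast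
  finally show ?thesis
    by simp
qed

end
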